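(* Let $r\ge1$ be an integer and let $\mathcal K$, $\kappa$ and $P_J$ be as defined in the context. Then for every $J\ge0$, in the operator norm on $L^2([0,1])$, $$\|P_J\mathcal K-\mathcal K\|\le \frac{2^{-Jr+1}}{4^r\,r!}\ \sup_{z,\xi\in[0,1]}\left|\frac{\partial^r\kappa(z-\xi,\tau)}{\partial z^r}\right| .$$
   Context: Parameters: $\sigma>0$, $0<L<U$, $T>0$, an integer $M\ge1$, $\tau=T/M$, $c^2=\sigma^2/2$, $\theta=\ln(U/L)$. $L^2([0,1])$ is the real Hilbert space with inner product $\langle f,g\rangle=\int_0^1 f(x)g(x)\,dx$. Kernel: $\kappa(z,\tau)=\dfrac{\theta}{\sqrt{4\pi c^2\tau}}\,e^{-(\theta z)^2/(4c^2\tau)}$. Integral operator $\mathcal K:L^2([0,1])\to L^2([0,1])$: $\mathcal K(f)(z)=\int_0^1\kappa(z-\xi,\tau)f(\xi)\,d\xi$. For $J\ge0$, $V_J\subset L^2([0,1])$ is the $r2^J$-dimensional space of functions whose restriction to each interval $[2^{-J}(i-1),2^{-J}i)$, $1\le i\le2^J$, is a polynomial of degree less than $r$. $P_J:L^2([0,1])\to V_J$ is the orthogonal projection onto $V_J$, and $(P_J\mathcal K)(f)=P_J(\mathcal K(f))$. *)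

theory Defs
  imports "HOL-Analysis.Analysis" "HOL-Computational_Algebra.Polynomial"
begin

text \<open>The real Hilbert space \<open>L\<^sup>2([0,1])\<close>, as square-integrable functions modulo equality
  almost everywhere on \<open>[0,1]\<close>.\<close>

definition square_integrable :: "(real \<Rightarrow> real) \<Rightarrow> bool" where
  "square_integrable f \<longleftrightarrow>
     f \<in> borel_measurable (lebesgue_on {0..1}) \<and> integrable (lebesgue_on {0..1}) (\<lambda>x. (f x)\<^sup>2)"

definition ae_eq :: "(real \<Rightarrow> real) \<Rightarrow> (real \<Rightarrow> real) \<Rightarrow> bool" where
  "ae_eq f g \<longleftrightarrow> square_integrable f \<and> square_integrable g \<and> (AE x in lebesgue_on {0..1}. f x = g x)"

lemma finite_measure_unit: "finite_measure (lebesgue_on {0..1::real})"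
  by (rule finite_measureI) (simp add: emeasure_restrict_space)

lemma continuous_on_interval_bounded:
  fixes g :: "real \<Rightarrow> real"
  assumes "continuous_on {a..b} g"
  obtains B where "\<And>x. x \<in> {a..b} \<Longrightarrow> \<bar>g x\<bar> \<le> B"
proof -
  have "bounded (g ` {a..b})"
    by (intro compact_imp_bounded compact_continuous_image assms) auto
  then have "\<exists>B. \<forall>x\<in>{a..b}. \<bar>g x\<bar> \<le> B" by (simp add: bounded_iff)
  with that show thesis by blast
qed

lemma square_integrable_bounded:
  assumes "f \<in> borel_measurable (lebesgue_on {0..1})" "\<And>x. x \<in> {0..1} \<Longrightarrow> \<bar>f x\<bar> \<le> B"
  shows "square_integrable f"
proof -
  interpret finite_measure "lebesgue_on {0..1::real}" by (rule finite_measure_unit)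
  have "(f x)\<^sup>2 \<le> B\<^sup>2" if "x \<in> {0..1}" for x
    using assms(2)[OF that] by (metis abs_ge_zero power2_abs power_mono)
  then have "integrable (lebesgue_on {0..1}) (\<lambda>x. (f x)\<^sup>2)"
    using assms(1) by (intro integrable_const_bound[where B="B\<^sup>2"]) (auto intro!: AE_I2)
  with assms(1) show ?thesis by (simp add: square_integrable_def)
qed

lemma square_integrable_mult:
  assumes "square_integrable f" "square_integrable g"
  shows "integrable (lebesgue_on {0..1}) (\<lambda>x. f x * g x)"
proof (rule Bochner_Integration.integrable_bound)
  show "integrable (lebesgue_on {0..1}) (\<lambda>x. (f x)\<^sup>2 + (g x)\<^sup>2)"
    using assms by (auto simp: square_integrable_def)
  show "(\<lambda>x. f x * g x) \<in> borel_measurable (lebesgue_on {0..1})"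
    using assms by (auto simp: square_integrable_def)
  have "\<bar>a * b\<bar> \<le> \<bar>a\<^sup>2 + b\<^sup>2\<bar>" for a b :: real
  proof -
    have "0 \<le> (\<bar>a\<bar> - \<bar>b\<bar>)\<^sup>2" by simp
    then have "2 * (\<bar>a\<bar> * \<bar>b\<bar>) \<le> a\<^sup>2 + b\<^sup>2" by (simp add: power2_diff)
    moreover have "0 \<le> \<bar>a\<bar> * \<bar>b\<bar>" by simp
    ultimately show ?thesis by (simp only: abs_mult)
  qed
  then show "AE x in lebesgue_on {0..1}. norm (f x * g x) \<le> norm ((f x)\<^sup>2 + (g x)\<^sup>2)"
    by (intro AE_I2) simp
qed

lemma square_integrable_zero: "square_integrable (\<lambda>_. 0)"
  by (simp add: square_integrable_def)

lemma square_integrable_one: "square_integrable (\<lambda>_. 1)"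
  by (rule square_integrable_bounded[where B=1]) auto

lemma square_integrable_scale: "square_integrable f \<Longrightarrow> square_integrable (\<lambda>x. a * f x)"
  by (auto simp: square_integrable_def power_mult_distrib)

lemma square_integrable_add:
  assumes "square_integrable f" "square_integrable g"
  shows "square_integrable (\<lambda>x. f x + g x)"
proof -
  have "(\<lambda>x. (f x + g x)\<^sup>2) = (\<lambda>x. (f x)\<^sup>2 + (g x)\<^sup>2 + 2 * (f x * g x))"
    by (auto simp: power2_sum)
  then show ?thesis
    using assms square_integrable_mult[OF assms] by (auto simp: square_integrable_def)
qed

quotient_type L2 = "real \<Rightarrow> real" / partial: ae_eq
proof (rule part_equivpI)
  show "\<exists>f. ae_eq f f"
    using square_integrable_zero by (auto simp: ae_eq_def)
  show "symp ae_eq"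
    by (rule sympI) (auto simp: ae_eq_def)
  show "transp ae_eq"
  proof (rule transpI)
    fix f g h assume "ae_eq f g" "ae_eq g h"
    then show "ae_eq f h"
      unfolding ae_eq_def by (auto elim: AE_mp)
  qed
qed

instantiation L2 :: real_inner
begin

lift_definition zero_L2 :: L2 is "\<lambda>_. 0"
  by (simp add: ae_eq_def square_integrable_zero)

lift_definition plus_L2 :: "L2 \<Rightarrow> L2 \<Rightarrow> L2" is "\<lambda>f g x. f x + g x"
  unfolding ae_eq_def by (auto intro: square_integrable_add elim: AE_mp)

lift_definition scaleR_L2 :: "real \<Rightarrow> L2 \<Rightarrow> L2" is "\<lambda>a f x. a * f x"
  unfolding ae_eq_def by (auto intro: square_integrable_scale elim: AE_mp)

definition uminus_L2 :: "L2 \<Rightarrow> L2" where "uminus_L2 F = (-1) *\<^sub>R F"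

definition minus_L2 :: "L2 \<Rightarrow> L2 \<Rightarrow> L2" where "minus_L2 F G = F + - G"

lift_definition inner_L2 :: "L2 \<Rightarrow> L2 \<Rightarrow> real" is
  "\<lambda>f g. \<integral>x. f x * g x \<partial>lebesgue_on {0..1}"
proof -
  fix f f' g g' assume "ae_eq f f'" "ae_eq g g'"
  then show "(\<integral>x. f x * g x \<partial>lebesgue_on {0..1}) = (\<integral>x. f' x * g' x \<partial>lebesgue_on {0..1})"
    unfolding ae_eq_def square_integrable_def by (intro integral_cong_AE) (auto elim: AE_mp)
qed

definition norm_L2 :: "L2 \<Rightarrow> real" where "norm_L2 F = sqrt (inner F F)"

definition dist_L2 :: "L2 \<Rightarrow> L2 \<Rightarrow> real" where "dist_L2 F G = norm (F - G)"

definition sgn_L2 :: "L2 \<Rightarrow> L2" where "sgn_L2 F = inverse (norm F) *\<^sub>R F"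

definition uniformity_L2 :: "(L2 \<times> L2) filter" where
  "uniformity_L2 = (INF e\<in>{0 <..}. principal {(F, G). dist F G < e})"

definition open_L2 :: "L2 set \<Rightarrow> bool" where
  "open_L2 S = (\<forall>F\<in>S. \<forall>\<^sub>F (F', G) in uniformity. F' = F \<longrightarrow> G \<in> S)"

instance
proof
  fix F G H :: L2 and a b :: real
  show "F + G + H = F + (G + H)"
    by transfer (auto simp: ae_eq_def add.assoc intro!: square_integrable_add)
  show "F + G = G + F"
    by transfer (auto simp: ae_eq_def add.commute intro!: square_integrable_add)
  show "0 + F = F"
    by transfer (auto simp: ae_eq_def)
  show "- F + F = 0"
    unfolding uminus_L2_def
    by transfer (auto simp: ae_eq_def square_integrable_zero)
  show "F - G = F + - G"
    by (simp add: minus_L2_def)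
  show "a *\<^sub>R (F + G) = a *\<^sub>R F + a *\<^sub>R G"
    by transfer (auto simp: ae_eq_def distrib_left intro!: square_integrable_add square_integrable_scale)
  show "(a + b) *\<^sub>R F = a *\<^sub>R F + b *\<^sub>R F"
    by transfer (auto simp: ae_eq_def distrib_right intro!: square_integrable_add square_integrable_scale)
  show "a *\<^sub>R b *\<^sub>R F = (a * b) *\<^sub>R F"
    by transfer (auto simp: ae_eq_def mult.assoc intro!: square_integrable_scale)
  show "1 *\<^sub>R F = F"
    by transfer (auto simp: ae_eq_def)
  show "inner F G = inner G F"
    by transfer (simp add: mult.commute)
  show "inner (F + G) H = inner F H + inner G H"
    by transfer (auto simp: ae_eq_def distrib_right square_integrable_mult)
  show "inner (a *\<^sub>R F) G = a * inner F G"
    by transfer (auto simp: mult.assoc)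
  show "0 \<le> inner F F"
    by transfer (auto intro: integral_nonneg_AE)
  show "inner F F = 0 \<longleftrightarrow> F = 0"
  proof transfer
    fix f assume "ae_eq f f"
    then have f: "square_integrable f" by (simp add: ae_eq_def)
    have "(\<integral>x. f x * f x \<partial>lebesgue_on {0..1}) = 0 \<longleftrightarrow> (AE x in lebesgue_on {0..1}. f x * f x = 0)"
      by (intro integral_nonneg_eq_0_iff_AE square_integrable_mult f) auto
    with f show "(\<integral>x. f x * f x \<partial>lebesgue_on {0..1}) = 0 \<longleftrightarrow> ae_eq f (\<lambda>_. 0)"
      by (simp add: ae_eq_def square_integrable_zero)
  qed
qed (simp_all add: norm_L2_def dist_L2_def sgn_L2_def uniformity_L2_def open_L2_def)

end

text \<open>Only \<open>c\<^sup>2 = \<sigma>\<^sup>2 / 2\<close> enters the kernel, so the sign of \<open>c\<close> is immaterial.\<close>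

definition kappa :: "real \<Rightarrow> real \<Rightarrow> real \<Rightarrow> real \<Rightarrow> real" where
  "kappa c \<theta> z \<tau> =
     \<theta> / sqrt (4 * pi * c\<^sup>2 * \<tau>) * exp (- (\<theta> * z)\<^sup>2 / (4 * c\<^sup>2 * \<tau>))"

lemma continuous_on_kappa: "continuous_on S (\<lambda>z. kappa c \<theta> z \<tau>)"
proof -
  have *: "(\<lambda>z. kappa c \<theta> z \<tau>) =
      (\<lambda>z. \<theta> / sqrt (4 * pi * c\<^sup>2 * \<tau>) * exp (- (\<theta> * z)\<^sup>2 * inverse (4 * c\<^sup>2 * \<tau>)))"
    unfolding kappa_def by (simp only: divide_inverse)
  show ?thesis by (subst *) (intro continuous_intros)
qed

lemma square_integrable_convolution:
  fixes k :: "real \<Rightarrow> real"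
  assumes k: "continuous_on UNIV k" and f: "square_integrable f"
  shows "square_integrable (\<lambda>z. \<integral>\<xi>. k (z - \<xi>) * f \<xi> \<partial>lebesgue_on {0..1})"
proof -
  let ?M = "lebesgue_on {0..1::real}"
  have fint: "integrable ?M (\<lambda>x. \<bar>f x\<bar>)"
    using square_integrable_mult[OF f square_integrable_one] by simp
  have fm: "f \<in> borel_measurable ?M" using f by (simp add: square_integrable_def)
  have km: "(\<lambda>\<xi>. k (z - \<xi>)) \<in> borel_measurable ?M" for z
  proof -
    have "continuous_on {0..1} (\<lambda>\<xi>. k (z - \<xi>))"
      by (rule continuous_on_compose2[OF k]) (auto intro!: continuous_intros)
    then show ?thesis by (rule continuous_imp_measurable_on_sets_lebesgue) simp
  qed
  obtain B where B: "\<And>y. y \<in> {-1..1} \<Longrightarrow> \<bar>k y\<bar> \<le> B"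
    using continuous_on_interval_bounded[OF continuous_on_subset[OF k subset_UNIV]] by blast
  have bd: "\<bar>k (z - \<xi>) * f \<xi>\<bar> \<le> B * \<bar>f \<xi>\<bar>" if "z \<in> {0..1}" "\<xi> \<in> {0..1}" for z \<xi>
    using that by (auto simp: abs_mult intro!: mult_right_mono B)
  have cont: "continuous_on {0..1} (\<lambda>z. \<integral>\<xi>. k (z - \<xi>) * f \<xi> \<partial>?M)"
    unfolding continuous_on_sequentially comp_def
  proof (intro allI ballI impI, elim conjE)
    fix u z assume z: "z \<in> {0..1}" and u: "\<forall>n::nat. u n \<in> {0..1::real}" "u \<longlonglongrightarrow> z"
    show "(\<lambda>n. \<integral>\<xi>. k (u n - \<xi>) * f \<xi> \<partial>?M) \<longlonglongrightarrow> (\<integral>\<xi>. k (z - \<xi>) * f \<xi> \<partial>?M)"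
    proof (rule integral_dominated_convergence[where w="\<lambda>\<xi>. B * \<bar>f \<xi>\<bar>"])
      have "isCont k y" for y using k by (simp add: continuous_on_eq_continuous_at)
      then have "(\<lambda>n. k (u n - \<xi>)) \<longlonglongrightarrow> k (z - \<xi>)" for \<xi>
        by (rule isCont_tendsto_compose) (intro tendsto_intros u)
      then show "AE \<xi> in ?M. (\<lambda>n. k (u n - \<xi>) * f \<xi>) \<longlonglongrightarrow> k (z - \<xi>) * f \<xi>"
        by (intro AE_I2 tendsto_intros) auto
      show "\<And>n. AE \<xi> in ?M. norm (k (u n - \<xi>) * f \<xi>) \<le> B * \<bar>f \<xi>\<bar>"
        using u bd by (intro AE_I2) auto
    qed (use fint fm km in auto)
  qed
  obtain C where "\<And>z. z \<in> {0..1} \<Longrightarrow> \<bar>\<integral>\<xi>. k (z - \<xi>) * f \<xi> \<partial>?M\<bar> \<le> C"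
    using continuous_on_interval_bounded[OF cont] by blast
  moreover have "(\<lambda>z. \<integral>\<xi>. k (z - \<xi>) * f \<xi> \<partial>?M) \<in> borel_measurable ?M"
    using cont by (rule continuous_imp_measurable_on_sets_lebesgue) simp
  ultimately show ?thesis by (rule square_integrable_bounded[rotated])
qed

lift_definition integral_op :: "real \<Rightarrow> real \<Rightarrow> real \<Rightarrow> L2 \<Rightarrow> L2" is
  "\<lambda>c \<theta> \<tau> f z. \<integral>\<xi>. kappa c \<theta> (z - \<xi>) \<tau> * f \<xi> \<partial>lebesgue_on {0..1}"
proof -
  fix c \<theta> \<tau> :: real and f g assume fg: "ae_eq f g"
  let ?K = "\<lambda>f z. \<integral>\<xi>. kappa c \<theta> (z - \<xi>) \<tau> * f \<xi> \<partial>lebesgue_on {0..1}"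
  have "?K f z = ?K g z" for z
  proof (rule integral_cong_AE)
    have m: "(\<lambda>\<xi>. kappa c \<theta> (z - \<xi>) \<tau>) \<in> borel_measurable (lebesgue_on {0..1})"
      by (intro continuous_imp_measurable_on_sets_lebesgue
            continuous_on_compose2[OF continuous_on_kappa[of UNIV]] continuous_intros) auto
    show "(\<lambda>\<xi>. kappa c \<theta> (z - \<xi>) \<tau> * f \<xi>) \<in> borel_measurable (lebesgue_on {0..1})"
      "(\<lambda>\<xi>. kappa c \<theta> (z - \<xi>) \<tau> * g \<xi>) \<in> borel_measurable (lebesgue_on {0..1})"
      using fg m by (auto simp: ae_eq_def square_integrable_def)
    show "AE \<xi> in lebesgue_on {0..1}. kappa c \<theta> (z - \<xi>) \<tau> * f \<xi> = kappa c \<theta> (z - \<xi>) \<tau> * g \<xi>"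
      using fg by (auto simp: ae_eq_def elim: AE_mp)
  qed
  moreover have "square_integrable (?K h)" if "square_integrable h" for h
    by (rule square_integrable_convolution[OF continuous_on_kappa that])
  ultimately show "ae_eq (?K f) (?K g)"
    using fg by (auto simp: ae_eq_def)
qed

text \<open>The point \<open>1\<close> lies in none of the half-open dyadic intervals; values there do not affect
  the class in \<open>L\<^sup>2([0,1])\<close>.\<close>

definition piecewise_poly :: "nat \<Rightarrow> nat \<Rightarrow> (real \<Rightarrow> real) \<Rightarrow> bool" where
  "piecewise_poly r J f \<longleftrightarrow>
     (\<forall>i\<in>{1..2 ^ J}. \<exists>p :: real poly. degree p < r \<and>
        (\<forall>x\<in>{(real i - 1) / 2 ^ J ..< real i / 2 ^ J}. f x = poly p x))"

definition poly_space :: "nat \<Rightarrow> nat \<Rightarrow> L2 set" where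
  "poly_space r J = {abs_L2 f | f. square_integrable f \<and> piecewise_poly r J f}"

text \<open>The description is meaningful whenever orthogonal projections onto \<open>S\<close> exist, in particular
  for every finite-dimensional subspace \<open>S\<close>.\<close>

definition orth_proj :: "'a::real_inner set \<Rightarrow> 'a \<Rightarrow> 'a" where
  "orth_proj S x = (THE y. y \<in> S \<and> (\<forall>s\<in>S. orthogonal (x - y) s))"

definition poly_proj :: "nat \<Rightarrow> nat \<Rightarrow> L2 \<Rightarrow> L2" where
  "poly_proj r J = orth_proj (poly_space r J)"

text \<open>Well-definedness: \<open>poly_space r J\<close> is finite-dimensional, \<open>poly_proj r J\<close> is the orthogonal projection
  onto it, and the operator in question is bounded, so that its \<open>onorm\<close> is meaningful.\<close>

lemma orth_proj_span:
  fixes B :: "'a::real_inner set"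
  assumes "finite B"
  shows "orth_proj (span B) x \<in> span B"
    and "\<And>s. s \<in> span B \<Longrightarrow> orthogonal (x - orth_proj (span B) x) s"
    and "\<And>y. y \<in> span B \<Longrightarrow> (\<And>s. s \<in> span B \<Longrightarrow> orthogonal (x - y) s) \<Longrightarrow> orth_proj (span B) x = y"
proof -
  obtain C where C: "finite C" "span C = span B" "pairwise orthogonal C"
    using basis_orthogonal[OF assms] by blast
  define y where "y = (\<Sum>b\<in>C. (inner b x / inner b b) *\<^sub>R b)"
  have y: "y \<in> span B"
    unfolding y_def C(2)[symmetric] by (intro span_sum span_scale span_base)
  have base: "orthogonal (x - y) b" if b: "b \<in> C" for b
  proof -
    have "inner y b = (\<Sum>a\<in>C. if a = b then inner b x else 0)"
      unfolding y_def inner_sum_left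
      using C(3) b by (intro sum.cong) (auto simp: pairwise_def orthogonal_def)
    then show ?thesis
      using C(1) b by (simp add: orthogonal_def inner_diff_left inner_commute[of b x])
  qed
  have "orthogonal s (x - y)" if "s \<in> span C" for s
    using that
    by (induction rule: span_induct_alt)
       (use base in \<open>auto simp: orthogonal_def inner_add_left inner_add_right inner_commute\<close>)
  then have orth: "orthogonal (x - y) s" if "s \<in> span B" for s
    using that C(2) by (auto simp: orthogonal_commute)
  have unique: "z = y" if z: "z \<in> span B" and "\<And>s. s \<in> span B \<Longrightarrow> orthogonal (x - z) s" for z
  proof -
    have d: "z - y \<in> span B" using y z by (rule span_diff[rotated])
    have "inner (x - y) (z - y) = 0" "inner (x - z) (z - y) = 0"
      using orth[OF d] that(2)[OF d] by (auto simp: orthogonal_def)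
    then have "inner (z - y) (z - y) = 0" by (simp add: inner_diff_left)
    then show "z = y" by simp
  qed
  have eq: "orth_proj (span B) x = y"
    unfolding orth_proj_def
  proof (rule the_equality)
    show "y \<in> span B \<and> (\<forall>s\<in>span B. orthogonal (x - y) s)" using y orth by blast
    show "\<And>z. z \<in> span B \<and> (\<forall>s\<in>span B. orthogonal (x - z) s) \<Longrightarrow> z = y"
      by (rule unique) blast+
  qed
  show "orth_proj (span B) x \<in> span B" unfolding eq by (rule y)
  show "\<And>s. s \<in> span B \<Longrightarrow> orthogonal (x - orth_proj (span B) x) s" unfolding eq by (rule orth)
  show "\<And>y'. y' \<in> span B \<Longrightarrow> (\<And>s. s \<in> span B \<Longrightarrow> orthogonal (x - y') s) \<Longrightarrow> orth_proj (span B) x = y'"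
    unfolding eq by (rule unique[symmetric])
qed

lemma bounded_linear_orth_proj:
  fixes B :: "'a::real_inner set"
  assumes "finite B"
  shows "bounded_linear (orth_proj (span B))"
proof (rule bounded_linear_intro[where K=1])
  note p = orth_proj_span[OF assms]
  fix x y :: 'a and a :: real
  show "orth_proj (span B) (x + y) = orth_proj (span B) x + orth_proj (span B) y"
  proof (rule p(3))
    fix s assume "s \<in> span B"
    then show "orthogonal (x + y - (orth_proj (span B) x + orth_proj (span B) y)) s"
      using p(2)[of s x] p(2)[of s y]
      by (simp add: orthogonal_def inner_diff_left inner_add_left)
  qed (intro span_add p(1))
  show "orth_proj (span B) (a *\<^sub>R x) = a *\<^sub>R orth_proj (span B) x"
  proof (rule p(3))
    fix s assume "s \<in> span B"
    then show "orthogonal (a *\<^sub>R x - a *\<^sub>R orth_proj (span B) x) s"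
      using p(2)[of s x] by (simp add: orthogonal_def inner_diff_left)
  qed (intro span_scale p(1))
  let ?q = "orth_proj (span B) x"
  have "orthogonal ?q (x - ?q)" using p(2)[OF p(1)] by (simp add: orthogonal_commute)
  then have "(norm (?q + (x - ?q)))\<^sup>2 = (norm ?q)\<^sup>2 + (norm (x - ?q))\<^sup>2"
    by (rule norm_add_Pythagorean)
  then have "(norm ?q)\<^sup>2 \<le> (norm x)\<^sup>2" by simp
  then show "norm ?q \<le> norm x * 1" by (simp add: power2_le_iff_abs_le)
qed

lemma square_integrable_sum:
  "(\<And>i. i \<in> I \<Longrightarrow> square_integrable (f i)) \<Longrightarrow> square_integrable (\<lambda>x. \<Sum>i\<in>I. f i x)"
  by (induction I rule: infinite_finite_induct)
     (auto intro: square_integrable_add square_integrable_zero)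

lemma abs_L2_add:
  "square_integrable f \<Longrightarrow> square_integrable g \<Longrightarrow> abs_L2 (\<lambda>x. f x + g x) = abs_L2 f + abs_L2 g"
  by (simp add: plus_L2.abs_eq ae_eq_def)

lemma abs_L2_scale: "square_integrable f \<Longrightarrow> abs_L2 (\<lambda>x. a * f x) = a *\<^sub>R abs_L2 f"
  by (simp add: scaleR_L2.abs_eq ae_eq_def)

lemma abs_L2_sum:
  "(\<And>i. i \<in> I \<Longrightarrow> square_integrable (f i)) \<Longrightarrow>
    abs_L2 (\<lambda>x. \<Sum>i\<in>I. f i x) = (\<Sum>i\<in>I. abs_L2 (f i))"
  by (induction I rule: infinite_finite_induct)
     (auto simp: zero_L2_def abs_L2_add square_integrable_sum)

lemma abs_L2_cong:
  assumes "square_integrable f" "square_integrable g" "\<And>x. x \<in> {0..<1} \<Longrightarrow> f x = g x"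
  shows "abs_L2 f = abs_L2 g"
proof -
  have "AE x in lebesgue_on {0..1::real}. x \<noteq> 1"
    by (subst AE_restrict_space_iff)
       (auto intro!: AE_completion intro: AE_mp[OF AE_lborel_singleton[of 1]])
  then have "AE x in lebesgue_on {0..1}. f x = g x"
    by (rule AE_mp) (use assms(3) in \<open>auto intro!: AE_I2\<close>)
  then have "ae_eq f g" using assms by (simp add: ae_eq_def)
  then show ?thesis using Quotient_rel[OF Quotient_L2] by blast
qed

definition local_monomial :: "nat \<Rightarrow> nat \<Rightarrow> nat \<Rightarrow> real \<Rightarrow> real" where
  "local_monomial J i k x = indicator {(real i - 1) / 2 ^ J ..< real i / 2 ^ J} x * x ^ k"

lemma square_integrable_local_monomial: "square_integrable (local_monomial J i k)"
proof (rule square_integrable_bounded[where B=1])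
  have "local_monomial J i k \<in> borel_measurable lborel"
    unfolding local_monomial_def by measurable
  then show "local_monomial J i k \<in> borel_measurable (lebesgue_on {0..1})"
    by (intro measurable_restrict_space1 measurable_completion)
  show "\<bar>local_monomial J i k x\<bar> \<le> 1" if "x \<in> {0..1}" for x
    using that by (auto simp: local_monomial_def indicator_def power_le_one)
qed

lemma dyadic_interval_ex1:
  assumes "x \<in> {0..<1::real}"
  obtains i where "i \<in> {1..2 ^ J}" "x \<in> {(real i - 1) / 2 ^ J ..< real i / 2 ^ J}"
proof
  define i where "i = nat \<lfloor>x * 2 ^ J\<rfloor> + 1"
  have x: "0 \<le> x * 2 ^ J" "x * 2 ^ J < 2 ^ J" using assms by auto
  then have "real (nat \<lfloor>x * 2 ^ J\<rfloor>) \<le> x * 2 ^ J" "x * 2 ^ J < real (nat \<lfloor>x * 2 ^ J\<rfloor>) + 1"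
    by linarith+
  then show "x \<in> {(real i - 1) / 2 ^ J ..< real i / 2 ^ J}"
    by (auto simp: i_def field_simps)
  have "real (nat \<lfloor>x * 2 ^ J\<rfloor>) < real (2 ^ J)" using x by (simp add: floor_less_iff)
  then have "nat \<lfloor>x * 2 ^ J\<rfloor> < 2 ^ J" by (simp only: of_nat_less_iff)
  then show "i \<in> {1..2 ^ J}" by (simp only: i_def atLeastAtMost_iff)
      linarith
qed

lemma dyadic_interval_unique:
  assumes "x \<in> {(real i - 1) / 2 ^ J ..< real i / 2 ^ J}"
    and "x \<in> {(real j - 1) / 2 ^ J ..< real j / 2 ^ J}"
  shows "i = j"
proof -
  have "x * 2 ^ J < real i" "real i \<le> x * 2 ^ J + 1" "x * 2 ^ J < real j" "real j \<le> x * 2 ^ J + 1"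
    using assms by (simp_all add: pos_le_divide_eq pos_divide_le_eq pos_less_divide_eq)
  then show ?thesis by linarith
qed

lemma sum_local_monomial:
  assumes "j \<in> {1..2 ^ J}" "x \<in> {(real j - 1) / 2 ^ J ..< real j / 2 ^ J}"
  shows "(\<Sum>(i, k)\<in>{1..2 ^ J} \<times> {..<r}. c i k * local_monomial J i k x) = (\<Sum>k<r. c j k * x ^ k)"
proof -
  have "(\<Sum>k<r. c i k * local_monomial J i k x) = (if i = j then \<Sum>k<r. c j k * x ^ k else 0)" for i
  proof (cases "i = j")
    case True
    then have "local_monomial J i k x = x ^ k" for k
      using assms(2) by (simp add: local_monomial_def)
    with True show ?thesis by simp
  next
    case False
    then have "x \<notin> {(real i - 1) / 2 ^ J ..< real i / 2 ^ J}"
      using dyadic_interval_unique[OF assms(2)] by blast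
    then have "local_monomial J i k x = 0" for k
      by (simp add: local_monomial_def del: atLeastLessThan_iff)
    with False show ?thesis by simp
  qed
  then show ?thesis
    using assms(1) by (simp add: sum.cartesian_product[symmetric])
qed

lemma poly_space_eq_span:
  assumes "r \<ge> 1"
  shows "poly_space r J = span ((\<lambda>(i, k). abs_L2 (local_monomial J i k)) ` ({1..2 ^ J} \<times> {..<r}))"
    (is "_ = span (?e ` ?I)")
proof (intro equalityI subsetI)
  fix F assume "F \<in> poly_space r J"
  then obtain f where f: "F = abs_L2 f" "square_integrable f" "piecewise_poly r J f"
    by (auto simp: poly_space_def)
  then obtain p where p: "\<And>i. i \<in> {1..2 ^ J} \<Longrightarrow> degree (p i) < r"
      "\<And>i x. i \<in> {1..2 ^ J} \<Longrightarrow> x \<in> {(real i - 1) / 2 ^ J ..< real i / 2 ^ J} \<Longrightarrow> f x = poly (p i) x"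
    unfolding piecewise_poly_def by metis
  have poly: "poly (p i) x = (\<Sum>k<r. coeff (p i) k * x ^ k)" if "i \<in> {1..2 ^ J}" for i x
    unfolding poly_altdef using p(1)[OF that]
    by (intro sum.mono_neutral_left) (auto simp: coeff_eq_0)
  let ?g = "\<lambda>x. \<Sum>(i, k)\<in>?I. coeff (p i) k * local_monomial J i k x"
  have sq: "square_integrable (\<lambda>x. coeff (p i) k * local_monomial J i k x)" for i k
    by (intro square_integrable_scale square_integrable_local_monomial)
  have "F = abs_L2 ?g"
    unfolding f(1)
  proof (rule abs_L2_cong)
    show "square_integrable f" by fact
    show "square_integrable ?g" by (intro square_integrable_sum) (auto intro: sq)
    fix x :: real assume "x \<in> {0..<1}"
    then obtain j where j: "j \<in> {1..2 ^ J}" "x \<in> {(real j - 1) / 2 ^ J ..< real j / 2 ^ J}"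
      by (rule dyadic_interval_ex1)
    show "f x = ?g x"
      using p(2)[OF j] poly[OF j(1)] sum_local_monomial[OF j] by simp
  qed
  also have "abs_L2 ?g = (\<Sum>(i, k)\<in>?I. coeff (p i) k *\<^sub>R abs_L2 (local_monomial J i k))"
    by (simp only: case_prod_unfold abs_L2_sum[OF sq]
        abs_L2_scale[OF square_integrable_local_monomial])
  also have "\<dots> \<in> span (?e ` ?I)"
    by (intro span_sum) (force intro: span_scale span_base)
  finally show "F \<in> span (?e ` ?I)" .
next
  have sub: "subspace (poly_space r J)"
  proof (rule subspaceI)
    have "piecewise_poly r J (\<lambda>_. 0)"
      unfolding piecewise_poly_def using assms by (auto intro!: exI[of _ 0])
    then show "0 \<in> poly_space r J"
      unfolding poly_space_def zero_L2_def using square_integrable_zero by auto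
  next
    fix F G assume "F \<in> poly_space r J" "G \<in> poly_space r J"
    then obtain f g where f: "F = abs_L2 f" "square_integrable f" "piecewise_poly r J f"
      and g: "G = abs_L2 g" "square_integrable g" "piecewise_poly r J g"
      by (auto simp: poly_space_def)
    have "piecewise_poly r J (\<lambda>x. f x + g x)"
      unfolding piecewise_poly_def
    proof
      fix i :: nat assume i: "i \<in> {1..2 ^ J}"
      obtain p where "degree p < r" "\<forall>x\<in>{(real i - 1) / 2 ^ J ..< real i / 2 ^ J}. f x = poly p x"
        using f(3) i unfolding piecewise_poly_def by blast
      moreover obtain q where "degree q < r" "\<forall>x\<in>{(real i - 1) / 2 ^ J ..< real i / 2 ^ J}. g x = poly q x"
        using g(3) i unfolding piecewise_poly_def by blast
      ultimately show "\<exists>p. degree p < r \<and>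
          (\<forall>x\<in>{(real i - 1) / 2 ^ J ..< real i / 2 ^ J}. f x + g x = poly p x)"
        by (intro exI[of _ "p + q"]) (auto intro: degree_add_less)
    qed
    then show "F + G \<in> poly_space r J"
      unfolding poly_space_def using f g
      by (auto intro!: exI[of _ "\<lambda>x. f x + g x"] square_integrable_add simp: abs_L2_add)
  next
    fix a F assume "F \<in> poly_space r J"
    then obtain f where f: "F = abs_L2 f" "square_integrable f" "piecewise_poly r J f"
      by (auto simp: poly_space_def)
    have "piecewise_poly r J (\<lambda>x. a * f x)"
      unfolding piecewise_poly_def
    proof
      fix i :: nat assume i: "i \<in> {1..2 ^ J}"
      obtain p where p: "degree p < r" "\<forall>x\<in>{(real i - 1) / 2 ^ J ..< real i / 2 ^ J}. f x = poly p x"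
        using f(3) i unfolding piecewise_poly_def by blast
      then show "\<exists>p. degree p < r \<and>
          (\<forall>x\<in>{(real i - 1) / 2 ^ J ..< real i / 2 ^ J}. a * f x = poly p x)"
        using le_less_trans[OF degree_smult_le p(1)] by (intro exI[of _ "smult a p"]) auto
    qed
    then show "a *\<^sub>R F \<in> poly_space r J"
      unfolding poly_space_def using f
      by (auto intro!: exI[of _ "\<lambda>x. a * f x"] square_integrable_scale simp: abs_L2_scale)
  qed
  have "piecewise_poly r J (local_monomial J i k)" if k: "k < r" for i k
    unfolding piecewise_poly_def
  proof
    fix j :: nat assume "j \<in> {1..2 ^ J}"
    have "local_monomial J i k x = poly (if i = j then monom 1 k else 0) x"
      if "x \<in> {(real j - 1) / 2 ^ J ..< real j / 2 ^ J}" for x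
    proof (cases "i = j")
      case True
      with that show ?thesis by (simp add: local_monomial_def poly_monom)
    next
      case False
      then have "x \<notin> {(real i - 1) / 2 ^ J ..< real i / 2 ^ J}"
        using dyadic_interval_unique[OF that] by blast
      with False show ?thesis
        by (simp add: local_monomial_def del: atLeastLessThan_iff)
    qed
    moreover have "degree (if i = j then monom 1 k else 0 :: real poly) < r"
      using k by (auto simp: degree_monom_eq)
    ultimately show "\<exists>p. degree p < r \<and>
        (\<forall>x\<in>{(real j - 1) / 2 ^ J ..< real j / 2 ^ J}. local_monomial J i k x = poly p x)"
      by blast
  qed
  then have "?e ` ?I \<subseteq> poly_space r J"
    unfolding poly_space_def using square_integrable_local_monomial by auto
  then have le: "span (?e ` ?I) \<subseteq> poly_space r J" using sub by (rule span_minimal)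
  fix F assume "F \<in> span (?e ` ?I)"
  with le show "F \<in> poly_space r J" by blast
qed

lemma bounded_linear_poly_proj: "r \<ge> 1 \<Longrightarrow> bounded_linear (poly_proj r J)"
  unfolding poly_proj_def by (subst poly_space_eq_span) (auto intro!: bounded_linear_orth_proj)

lemma norm_abs_L2_le:
  assumes f: "square_integrable f" and B: "0 \<le> B" "\<And>x. x \<in> {0..1} \<Longrightarrow> \<bar>f x\<bar> \<le> B"
  shows "norm (abs_L2 f) \<le> B"
proof -
  have "inner (abs_L2 f) (abs_L2 f) = (\<integral>x. f x * f x \<partial>lebesgue_on {0..1})"
    using f by (simp add: inner_L2.abs_eq ae_eq_def)
  also have "\<dots> \<le> (\<integral>x. B * B \<partial>lebesgue_on {0..1::real})"
  proof (rule integral_mono)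
    show "integrable (lebesgue_on {0..1}) (\<lambda>x. f x * f x)" by (rule square_integrable_mult[OF f f])
    show "integrable (lebesgue_on {0..1::real}) (\<lambda>x. B * B)"
      using finite_measure_unit finite_measure.integrable_const by blast
    fix x :: real assume "x \<in> space (lebesgue_on {0..1})"
    then have "\<bar>f x\<bar> * \<bar>f x\<bar> \<le> B * B" by (intro mult_mono B) auto
    then show "f x * f x \<le> B * B" by (simp add: abs_mult[symmetric])
  qed
  also have "\<dots> = B\<^sup>2" by (simp add: measure_restrict_space power2_eq_square)
  finally show ?thesis using B(1) by (simp add: norm_eq_sqrt_inner real_le_lsqrt)
qed

lemma bounded_linear_integral_op: "bounded_linear (integral_op c \<theta> \<tau>)"
proof -
  let ?M = "lebesgue_on {0..1::real}"
  let ?k = "\<lambda>z \<xi>. kappa c \<theta> (z - \<xi>) \<tau>"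
  obtain B where B: "\<And>y. y \<in> {-1..1} \<Longrightarrow> \<bar>kappa c \<theta> y \<tau>\<bar> \<le> B"
    using continuous_on_interval_bounded[where g="\<lambda>z. kappa c \<theta> z \<tau>" and a="-1" and b=1]
      continuous_on_kappa by blast
  have B0: "0 \<le> B" using B[of 0] by auto
  have ksq: "square_integrable (?k z)" if "z \<in> {0..1}" for z
  proof (rule square_integrable_bounded)
    show "?k z \<in> borel_measurable ?M"
      by (intro continuous_imp_measurable_on_sets_lebesgue
            continuous_on_compose2[OF continuous_on_kappa[of UNIV]] continuous_intros) auto
    show "\<And>x. x \<in> {0..1} \<Longrightarrow> \<bar>?k z x\<bar> \<le> B" using that by (intro B) auto
  qed
  show ?thesis
  proof (rule bounded_linear_intro[where K=B])
    fix F G :: L2 and a :: real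
    obtain f where F: "F = abs_L2 f" and f: "square_integrable f"
      using Quotient_abs_rep[OF Quotient_L2] Quotient_rep_reflp[OF Quotient_L2]
      by (metis ae_eq_def)
    obtain g where G: "G = abs_L2 g" and g: "square_integrable g"
      using Quotient_abs_rep[OF Quotient_L2] Quotient_rep_reflp[OF Quotient_L2]
      by (metis ae_eq_def)
    let ?K = "\<lambda>f z. \<integral>\<xi>. ?k z \<xi> * f \<xi> \<partial>?M"
    have K: "integral_op c \<theta> \<tau> (abs_L2 h) = abs_L2 (?K h)" if "square_integrable h" for h
      using that by (simp add: integral_op.abs_eq ae_eq_def)
    have Ksq: "square_integrable (?K h)" if "square_integrable h" for h
      by (rule square_integrable_convolution[OF continuous_on_kappa that])
    have Kadd: "?K (\<lambda>x. f x + g x) z = ?K f z + ?K g z" if "z \<in> {0..1}" for z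
      using square_integrable_mult[OF ksq[OF that] f] square_integrable_mult[OF ksq[OF that] g]
      by (simp add: distrib_left)
    have Kscale: "?K (\<lambda>x. a * f x) z = a * ?K f z" for z
      by (simp add: mult.left_commute)
    show "integral_op c \<theta> \<tau> (F + G) = integral_op c \<theta> \<tau> F + integral_op c \<theta> \<tau> G"
      unfolding F G
      by (simp only: abs_L2_add[OF f g, symmetric] K f g square_integrable_add
            abs_L2_add[OF Ksq[OF f] Ksq[OF g], symmetric])
         (intro abs_L2_cong Ksq square_integrable_add f g Kadd, auto)
    show "integral_op c \<theta> \<tau> (a *\<^sub>R F) = a *\<^sub>R integral_op c \<theta> \<tau> F"
      unfolding F
      by (simp only: abs_L2_scale[OF f, symmetric] K f square_integrable_scale
            abs_L2_scale[OF Ksq[OF f], symmetric] Kscale)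
    have "\<bar>?K f z\<bar> \<le> norm F * B" if z: "z \<in> {0..1}" for z
    proof -
      have "?K f z = inner (abs_L2 (?k z)) F"
        unfolding F using f ksq[OF z] by (simp add: inner_L2.abs_eq ae_eq_def)
      also have "\<bar>\<dots>\<bar> \<le> norm (abs_L2 (?k z)) * norm F" by (rule Cauchy_Schwarz_ineq2)
      also have "\<dots> \<le> B * norm F"
        using z by (intro mult_right_mono norm_abs_L2_le ksq B0 B) auto
      finally show ?thesis by (simp add: mult.commute)
    qed
    then show "norm (integral_op c \<theta> \<tau> F) \<le> norm F * B"
      unfolding F K[OF f] using B0 by (intro norm_abs_L2_le Ksq f) (auto simp: F)
  qed
qed

lemma bounded_linear_projection_error:
  "r \<ge> 1 \<Longrightarrow> bounded_linear (\<lambda>F. poly_proj r J (integral_op c \<theta> \<tau> F) - integral_op c \<theta> \<tau> F)"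
  by (intro bounded_linear_sub bounded_linear_compose[OF bounded_linear_poly_proj]
        bounded_linear_integral_op)

end

(* On a dyadic interval of length h, the zeros of the transplanted Chebyshev polynomial of degree r
   are r nodes whose nodal polynomial is bounded by 2 (h/4)^r, so interpolating kappa(. - xi) there
   has error at most 2 (h/4)^r / r! times the supremum of the r-th derivative. Interpolation is
   linear in the nodal values and hence commutes with integration against f(xi): the piecewise
   interpolant of K f lies in V_J and differs from K f by at most the same constant times the norm
   of f, and the orthogonal projection is at least as good. *)

theory Submission
  imports Defs
begin

section \<open>Rolle's theorem, the interpolation remainder, and Lagrange interpolants\<close>

section \<open>Polynomial interpolation\<close>

text \<open>Induction on the number of zeros, removing the largest. Rolle between the two largest
  zeros gives a zero of \<open>g'\<close> strictly above the second largest, while the induction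
  hypothesis keeps the others strictly below it. The half-open range \<open>{a..<Max Z}\<close> is
  what makes the new zero distinct from the old ones.\<close>

lemma Rolle_finite_zeros:
  fixes g g' :: "real \<Rightarrow> real"
  assumes "finite Z" "card Z = Suc n" "Z \<subseteq> {a..b}" "\<And>x. x \<in> Z \<Longrightarrow> g x = 0"
    and deriv: "\<And>x. x \<in> {a..b} \<Longrightarrow> (g has_real_derivative g' x) (at x)"
  shows "\<exists>Z'. finite Z' \<and> card Z' = n \<and> Z' \<subseteq> {a..<Max Z} \<and> (\<forall>x\<in>Z'. g' x = 0)"
  using assms(1-4)
proof (induction n arbitrary: Z)
  case 0
  show ?case by (intro exI[of _ "{}"]) auto
next
  case (Suc n)
  let ?M = "Max Z" let ?Y = "Z - {?M}" let ?m = "Max ?Y"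
  have "Z \<noteq> {}" using Suc.prems by auto
  then have M: "?M \<in> Z" using Suc.prems by simp
  then have cY: "card ?Y = Suc n" using Suc.prems by simp
  then have "?Y \<noteq> {}" by (metis card.empty nat.distinct(1))
  then have m: "?m \<in> ?Y" using Suc.prems by (intro Max_in) auto
  then have mM: "?m < ?M" using Suc.prems(1) by (auto simp: less_le)
  obtain Y' where Y': "finite Y'" "card Y' = n" "Y' \<subseteq> {a..<?m}" "\<forall>x\<in>Y'. g' x = 0"
    using Suc.IH[of ?Y] cY Suc.prems by auto
  have ab: "{?m..?M} \<subseteq> {a..b}" using m M Suc.prems(3) by fastforce
  have "\<exists>w>?m. w < ?M \<and> (\<lambda>h. g' w * h) = (\<lambda>v. 0)"
  proof (rule Rolle_deriv[OF mM])
    show "g ?m = g ?M" using m M Suc.prems(4) by auto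
    show "continuous_on {?m..?M} g"
      using ab by (intro DERIV_continuous_on) (blast intro: deriv DERIV_subset)
    show "\<And>x. ?m < x \<Longrightarrow> x < ?M \<Longrightarrow> (g has_derivative (\<lambda>h. g' x * h)) (at x)"
      using ab deriv by (auto simp: has_field_derivative_def subset_iff)
  qed
  then obtain w where w: "?m < w" "w < ?M" "g' w = 0" by (metis mult.right_neutral)
  have "w \<notin> Y'" using Y'(3) w(1) by fastforce
  moreover have "a \<le> ?m" using ab mM by auto
  ultimately show ?case
    using Y' w mM by (intro exI[of _ "insert w Y'"]) force
qed

text \<open>Each differentiation loses one zero, so n + 1 zeros of \<open>D 0\<close> leave one for
  \<open>D n\<close>. The induction passes to the shifted family \<open>D (Suc m)\<close>.\<close>

lemma iterated_Rolle:
  fixes D :: "nat \<Rightarrow> real \<Rightarrow> real"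
  assumes "finite Z" "card Z = Suc n" "Z \<subseteq> {a..b}" "\<And>x. x \<in> Z \<Longrightarrow> D 0 x = 0"
    and "\<And>m x. m < n \<Longrightarrow> x \<in> {a..b} \<Longrightarrow> (D m has_real_derivative D (Suc m) x) (at x)"
  shows "\<exists>x\<in>{a..b}. D n x = 0"
  using assms
proof (induction n arbitrary: D Z)
  case 0
  then obtain z where "z \<in> Z" by fastforce
  with 0 show ?case by blast
next
  case (Suc n)
  obtain Z' where Z': "finite Z'" "card Z' = Suc n" "Z' \<subseteq> {a..<Max Z}" "\<forall>x\<in>Z'. D (Suc 0) x = 0"
    using Rolle_finite_zeros[OF Suc.prems(1-3), of "D 0" "D (Suc 0)"] Suc.prems(4,5) by auto
  have "Max Z \<in> Z" using Suc.prems by (intro Max_in) auto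
  then have "Z' \<subseteq> {a..b}" using Z'(3) Suc.prems(3) by fastforce
  then show ?case
    using Suc.IH[of Z' "\<lambda>m. D (Suc m)"] Z' Suc.prems(5) by auto
qed

lemma degree_prod_linear_factors: "degree (\<Prod>x\<in>N. [:- x, 1 :: real:]) = card N"
  by (subst degree_prod_eq_sum_degree) auto

lemma poly_prod_linear_factors: "poly (\<Prod>x\<in>N. [:- x, 1 :: real:]) z = (\<Prod>x\<in>N. z - x)"
  by (simp add: poly_prod)

lemma lead_coeff_prod_linear_factors: "coeff (\<Prod>x\<in>N. [:- x, 1 :: real:]) (card N) = 1"
  using lead_coeff_prod[of "\<lambda>x. [:- x, 1 :: real:]" N] by (simp add: degree_prod_linear_factors)

text \<open>The classical remainder argument: add to \<open>p\<close> the multiple of the nodal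
  polynomial that makes \<open>D 0 - q\<close> vanish at \<open>z\<close> as well. This difference
  has one zero more than there are nodes, so its derivative of order \<open>card N\<close> vanishes
  somewhere.\<close>

lemma interpolation_error:
  fixes D :: "nat \<Rightarrow> real \<Rightarrow> real"
  assumes N: "finite N" "N \<subseteq> {a..b}" and z: "z \<in> {a..b}"
    and deriv: "\<And>m x. m < card N \<Longrightarrow> x \<in> {a..b} \<Longrightarrow> (D m has_real_derivative D (Suc m) x) (at x)"
    and p: "degree p < card N" "\<And>x. x \<in> N \<Longrightarrow> poly p x = D 0 x"
  shows "\<exists>\<eta>\<in>{a..b}. D 0 z - poly p z = D (card N) \<eta> / fact (card N) * (\<Prod>x\<in>N. z - x)"
proof (cases "z \<in> N")
  case True
  \<comment> \<open>At a node both sides vanish, so any point of the interval serves as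
    \<open>\<eta>\<close>.\<close>
  then have "(\<Prod>x\<in>N. z - x) = 0" using N by (auto simp: prod_zero_iff)
  with True p(2) z show ?thesis by force
next
  case False
  let ?n = "card N"
  let ?w = "\<Prod>x\<in>N. [:- x, 1 :: real:]"
  have w0: "(\<Prod>x\<in>N. z - x) \<noteq> 0" using N False by (auto simp: prod_zero_iff)
  define l where "l = (D 0 z - poly p z) / (\<Prod>x\<in>N. z - x)"
  define q where "q = p + smult l ?w"
  \<comment> \<open>\<open>q\<close> has degree at most \<open>?n\<close>, so differentiating
    \<open>?n\<close> times leaves only the contribution of this coefficient, a constant.\<close>
  have "coeff q ?n = l"
    using p(1) by (simp add: q_def lead_coeff_prod_linear_factors coeff_eq_0)
  moreover have "degree q \<le> ?n"
    unfolding q_def using p(1) degree_smult_le[of l ?w]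
    by (intro degree_add_le) (auto simp: degree_prod_linear_factors)
  ultimately have q: "(pderiv ^^ ?n) q = [:fact ?n * l:]"
    by (intro poly_eqI)
       (auto simp: coeff_higher_pderiv coeff_pCons coeff_eq_0 pochhammer_fact split: nat.split)
  let ?E = "\<lambda>m x. D m x - poly ((pderiv ^^ m) q) x"
  have "\<exists>x\<in>{a..b}. ?E ?n x = 0"
  proof (rule iterated_Rolle[where Z = "insert z N"])
    show "card (insert z N) = Suc ?n" using N False by simp
    show "?E 0 x = 0" if "x \<in> insert z N" for x
    proof (cases "x = z")
      case True
      then show ?thesis using w0 by (simp add: q_def poly_prod_linear_factors l_def)
    next
      case False
      with that have "x \<in> N" by simp
      then have "poly ?w x = 0" using N by (auto simp: poly_prod_linear_factors prod_zero_iff)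
      then show ?thesis using p(2) \<open>x \<in> N\<close> by (simp add: q_def)
    qed
    show "(?E m has_real_derivative ?E (Suc m) x) (at x)" if "m < ?n" "x \<in> {a..b}" for m x
      by (auto intro!: derivative_eq_intros deriv[OF that])
  qed (use N z in auto)
  then obtain \<eta> where "\<eta> \<in> {a..b}" "D ?n \<eta> = fact ?n * l" by (auto simp: q)
  then show ?thesis using w0 by (intro bexI[of _ \<eta>]) (auto simp: l_def)
qed

definition lagrange_basis :: "real set \<Rightarrow> real \<Rightarrow> real poly" where
  "lagrange_basis N x = smult (inverse (\<Prod>y\<in>N - {x}. x - y)) (\<Prod>y\<in>N - {x}. [:- y, 1:])"

lemma degree_lagrange_basis:
  assumes "finite N" "x \<in> N"
  shows "degree (lagrange_basis N x) < card N"
proof -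
  have "degree (lagrange_basis N x) \<le> card (N - {x})"
    unfolding lagrange_basis_def using degree_smult_le degree_prod_linear_factors by metis
  then show ?thesis using card_Diff1_less[OF assms] by linarith
qed

lemma poly_lagrange_basis:
  assumes "finite N" "x \<in> N" "y \<in> N"
  shows "poly (lagrange_basis N x) y = (if y = x then 1 else 0)"
  using assms by (auto simp: lagrange_basis_def poly_prod_linear_factors prod_zero_iff)

text \<open>The explicit sum over nodal values makes linearity in \<open>f\<close> visible; this is
  what later allows interpolation to be exchanged with the integral over
  \<open>\<xi>\<close>.\<close>

definition lagrange_interpolant :: "real set \<Rightarrow> (real \<Rightarrow> real) \<Rightarrow> real poly" where
  "lagrange_interpolant N f = (\<Sum>x\<in>N. smult (f x) (lagrange_basis N x))"

lemma degree_lagrange_interpolant: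
  assumes "finite N" "N \<noteq> {}"
  shows "degree (lagrange_interpolant N f) < card N"
proof -
  have "degree (lagrange_interpolant N f) \<le> card N - 1"
    unfolding lagrange_interpolant_def
  proof (rule degree_sum_le[OF assms(1)])
    fix x assume "x \<in> N"
    then show "degree (smult (f x) (lagrange_basis N x)) \<le> card N - 1"
      using degree_lagrange_basis[OF assms(1)] degree_smult_le[of "f x" "lagrange_basis N x"]
      by fastforce
  qed
  then show ?thesis using assms card_gt_0_iff[of N] by linarith
qed

lemma poly_lagrange_interpolant:
  assumes "finite N" "y \<in> N"
  shows "poly (lagrange_interpolant N f) y = f y"
proof -
  have "poly (lagrange_interpolant N f) y = (\<Sum>x\<in>N. if x = y then f y else 0)"
    unfolding lagrange_interpolant_def poly_sum
    using assms by (intro sum.cong) (auto simp: poly_lagrange_basis)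
  then show ?thesis using assms by simp
qed

section \<open>Chebyshev polynomials, their zeros, and the size of the nodal polynomial\<close>

section \<open>Chebyshev nodes\<close>

fun chebyshev :: "nat \<Rightarrow> real poly" where
  "chebyshev 0 = 1"
| "chebyshev (Suc 0) = [:0, 1:]"
| "chebyshev (Suc (Suc n)) = [:0, 2:] * chebyshev (Suc n) - chebyshev n"

text \<open>The recurrence mirrors cos((n+2)t) + cos(nt) = 2 cos(t) cos((n+1)t).\<close>

lemma poly_chebyshev_cos: "poly (chebyshev n) (cos t) = cos (real n * t)"
proof (induction n rule: chebyshev.induct)
  case (3 n)
  have "cos (a + t) + cos (a - t) = 2 * cos t * cos a" for a
    by (simp add: cos_add cos_diff)
  from this[of "real (Suc n) * t"]
  have "cos (real (Suc (Suc n)) * t) = 2 * cos t * cos (real (Suc n) * t) - cos (real n * t)"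
    by (simp add: algebra_simps)
  then show ?case by (simp only: chebyshev.simps poly_diff poly_mult 3) simp
qed auto

lemma degree_chebyshev: "degree (chebyshev n) \<le> n"
proof (induction n rule: chebyshev.induct)
  case (3 n)
  have "degree ([:0, 2:] * chebyshev (Suc n)) \<le> Suc (Suc n)"
    using degree_mult_le[of "[:0, 2:]" "chebyshev (Suc n)"] 3 by auto
  then show ?case using 3 by (auto intro!: degree_diff_le)
qed auto

lemma lead_coeff_chebyshev: "coeff (chebyshev (Suc n)) (Suc n) = 2 ^ n"
proof (induction n)
  case (Suc n)
  have "coeff (chebyshev n) (Suc (Suc n)) = 0"
    using degree_chebyshev[of n] by (intro coeff_eq_0) linarith
  with Suc show ?case by simp
qed auto

text \<open>For positive n, the angles are the points t of [0, pi] at which cos(nt) = 0.\<close>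

definition chebyshev_nodes :: "nat \<Rightarrow> real set" where
  "chebyshev_nodes n = (\<lambda>j. cos (real (2 * j + 1) * pi / (2 * real n))) ` {..<n}"

lemma chebyshev_nodes:
  assumes "n \<ge> 1"
  shows "finite (chebyshev_nodes n)" "card (chebyshev_nodes n) = n"
    "\<And>x. x \<in> chebyshev_nodes n \<Longrightarrow> poly (chebyshev n) x = 0"
    "chebyshev_nodes n \<subseteq> {-1..1}"
proof -
  let ?t = "\<lambda>j. real (2 * j + 1) * pi / (2 * real n)"
  show "finite (chebyshev_nodes n)" by (simp add: chebyshev_nodes_def)
  \<comment> \<open>Cosine is injective on [0, pi], so distinct angles give n distinct
    nodes.\<close>
  have t: "?t j \<in> {0..pi}" if "j < n" for j
  proof -
    have "real (2 * j + 1) * pi \<le> 2 * real n * pi"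
      using that by (intro mult_right_mono) auto
    then show ?thesis using assms by (auto simp: field_simps)
  qed
  have "inj_on (\<lambda>j. cos (?t j)) {..<n}"
  proof (rule inj_onI)
    fix i j assume ij: "i \<in> {..<n}" "j \<in> {..<n}" "cos (?t i) = cos (?t j)"
    then have "?t i = ?t j" using t[of i] t[of j] cos_inj_pi[of "?t i" "?t j"] by auto
    then show "i = j" using assms by simp
  qed
  then show "card (chebyshev_nodes n) = n" by (simp add: chebyshev_nodes_def card_image)
  fix x assume "x \<in> chebyshev_nodes n"
  then obtain j where j: "x = cos (?t j)" by (auto simp: chebyshev_nodes_def)
  have "real n * ?t j = of_int (2 * int j + 1) * (pi / 2)" using assms by (simp add: field_simps)
  moreover have "odd (2 * int j + 1)" by simp
  ultimately have "cos (real n * ?t j) = 0" unfolding cos_zero_iff_int by blast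
  then show "poly (chebyshev n) x = 0" by (simp only: j poly_chebyshev_cos)
next
  show "chebyshev_nodes n \<subseteq> {-1..1}" by (auto simp: chebyshev_nodes_def)
qed

text \<open>Both sides have degree at most n and the same coefficient at n. Their difference would
  have degree below n and yet vanish at n distinct nodes, so it is zero.\<close>

lemma chebyshev_factorization:
  assumes "n \<ge> 1"
  shows "chebyshev n = smult (2 ^ (n - 1)) (\<Prod>x\<in>chebyshev_nodes n. [:- x, 1:])"
    (is "_ = smult _ ?w")
proof (rule ccontr)
  note N = chebyshev_nodes[OF assms]
  let ?d = "chebyshev n - smult (2 ^ (n - 1)) ?w"
  assume "chebyshev n \<noteq> smult (2 ^ (n - 1)) ?w"
  then have d: "?d \<noteq> 0" by simp
  have "degree ?w = n" using degree_prod_linear_factors[of "chebyshev_nodes n"] N(2) by simp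
  then have "degree ?d \<le> n"
    using degree_chebyshev[of n] by (intro degree_diff_le) auto
  moreover have "coeff ?d n = 0"
    using lead_coeff_chebyshev[of "n - 1"] lead_coeff_prod_linear_factors[of "chebyshev_nodes n"]
      assms by (simp add: N(2))
  ultimately have "degree ?d < n" using d by (metis le_less leading_coeff_0_iff)
  moreover have "chebyshev_nodes n \<subseteq> {x. poly ?d x = 0}"
    using N(1,3) by (auto simp: poly_prod_linear_factors prod_zero_iff)
  then have "n \<le> card {x. poly ?d x = 0}"
    using card_mono[OF poly_roots_finite[OF d]] N(2) by metis
  ultimately show False using card_poly_roots_bound[OF d] by linarith
qed

text \<open>On [-1, 1] the Chebyshev polynomial takes values cos(nt), hence is at most 1 in modulus;
  dividing by its leading coefficient 2^(n-1) gives the bound.\<close>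

lemma abs_prod_chebyshev_nodes_le:
  assumes n: "n \<ge> 1" and x: "x \<in> {-1..1}"
  shows "\<bar>\<Prod>y\<in>chebyshev_nodes n. x - y\<bar> \<le> 2 / 2 ^ n"
proof -
  have "\<bar>poly (chebyshev n) x\<bar> \<le> 1"
    using x poly_chebyshev_cos[of n "arccos x"] by simp
  then have "2 ^ (n - 1) * \<bar>\<Prod>y\<in>chebyshev_nodes n. x - y\<bar> \<le> 1"
    by (simp add: chebyshev_factorization[OF n] poly_prod_linear_factors abs_mult)
  moreover have "(2::real) ^ n = 2 * 2 ^ (n - 1)" using n by (cases n) auto
  ultimately show ?thesis by (simp add: field_simps)
qed

text \<open>Transplant the nodes by the affine bijection \<open>\<phi>\<close> from [-1, 1] to
  [a, b]. Each of the n factors scales by (b - a)/2, which combines with 2/2^n to give the stated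
  constant.\<close>

lemma chebyshev_nodes_interval:
  fixes a b :: real
  assumes n: "n \<ge> 1" and ab: "a < b"
  obtains N where "finite N" "card N = n" "N \<subseteq> {a..b}"
    "\<And>z. z \<in> {a..b} \<Longrightarrow> \<bar>\<Prod>x\<in>N. z - x\<bar> \<le> 2 * ((b - a) / 4) ^ n"
proof -
  note C = chebyshev_nodes[OF n]
  let ?h = "(b - a) / 2"
  define \<phi> where "\<phi> = (\<lambda>x. (a + b) / 2 + ?h * x)"
  have h: "?h > 0" using ab by simp
  have inj: "inj_on \<phi> S" for S using h by (auto simp: \<phi>_def inj_on_def)
  have "\<phi> y \<in> {a..b}" if "y \<in> {-1..1}" for y
  proof -
    have "?h * y \<le> ?h * 1" "?h * (-1) \<le> ?h * y"
      using that h by (intro mult_left_mono; simp)+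
    then show ?thesis by (auto simp: \<phi>_def field_simps)
  qed
  then have 1: "\<phi> ` chebyshev_nodes n \<subseteq> {a..b}" using C(4) by blast
  have 2: "\<bar>\<Prod>x\<in>\<phi> ` chebyshev_nodes n. z - x\<bar> \<le> 2 * ((b - a) / 4) ^ n" if z: "z \<in> {a..b}" for z
  proof -
    define y where "y = (z - (a + b) / 2) / ?h"
    have hy: "?h * y = z - (a + b) / 2"
      unfolding y_def times_divide_eq_right by (rule nonzero_mult_div_cancel_left) (use h in linarith)
    then have zy: "z = \<phi> y" unfolding \<phi>_def hy by linarith
    have "?h * (-1) \<le> ?h * y" "?h * y \<le> ?h * 1"
      unfolding hy using z by (auto simp: field_simps)
    then have y: "y \<in> {-1..1}" unfolding mult_le_cancel_left_pos[OF h] by simp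
    have "(\<Prod>x\<in>\<phi> ` chebyshev_nodes n. z - x) = (\<Prod>x\<in>chebyshev_nodes n. ?h * (y - x))"
      unfolding prod.reindex[OF inj] o_def zy
      by (intro prod.cong refl) (simp only: \<phi>_def right_diff_distrib add_diff_cancel_left)
    also have "\<dots> = ?h ^ n * (\<Prod>x\<in>chebyshev_nodes n. y - x)"
      by (simp only: prod.distrib prod_constant C(2))
    also have "\<bar>\<dots>\<bar> = ?h ^ n * \<bar>\<Prod>x\<in>chebyshev_nodes n. y - x\<bar>"
      using h by (simp add: abs_mult)
    also have "\<dots> \<le> ?h ^ n * (2 / 2 ^ n)"
      using h by (intro mult_left_mono abs_prod_chebyshev_nodes_le n y) auto
    also have "\<dots> = 2 * ((b - a) / 4) ^ n"
      by (simp add: power_divide power_mult_distrib[symmetric])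
    finally show ?thesis .
  qed
  show ?thesis
    using that[of "\<phi> ` chebyshev_nodes n"] C 1 2 card_image[OF inj] by auto
qed

section \<open>Iterated derivatives of the Gaussian kernel\<close>

section \<open>The kernel\<close>

text \<open>The polynomial factor in the m-th derivative of exp(-A z^2); for A > 0 these are the
  Hermite polynomials up to scaling. The recursion is the product rule.\<close>

primrec kappa_deriv_factor :: "real \<Rightarrow> nat \<Rightarrow> real poly" where
  "kappa_deriv_factor A 0 = 1"
| "kappa_deriv_factor A (Suc m) = pderiv (kappa_deriv_factor A m) - [:0, 2 * A:] * kappa_deriv_factor A m"

lemma DERIV_poly_kappa:
  assumes "A = \<theta>\<^sup>2 / (4 * c\<^sup>2 * \<tau>)"
  shows "((\<lambda>x. poly p (x - \<xi>) * kappa c \<theta> (x - \<xi>) \<tau>) has_real_derivative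
    poly (pderiv p - [:0, 2 * A:] * p) (x - \<xi>) * kappa c \<theta> (x - \<xi>) \<tau>) (at x)"
proof -
  have k: "kappa c \<theta> z \<tau> = \<theta> / sqrt (4 * pi * c\<^sup>2 * \<tau>) * exp (- (A * z\<^sup>2))" for z
    by (simp add: kappa_def assms power_mult_distrib)
  have p: "((\<lambda>x. poly p (x - \<xi>)) has_real_derivative poly (pderiv p) (x - \<xi>)) (at x)"
    by (auto intro!: derivative_eq_intros DERIV_chain'[where g = "poly p"])
  show ?thesis
    unfolding k
    by (rule derivative_eq_intros p refl)+ (simp add: algebra_simps add_divide_distrib)
qed

lemma deriv_funpow_kappa:
  assumes "A = \<theta>\<^sup>2 / (4 * c\<^sup>2 * \<tau>)"
  shows "(deriv ^^ m) (\<lambda>x. kappa c \<theta> (x - \<xi>) \<tau>) =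
    (\<lambda>x. poly (kappa_deriv_factor A m) (x - \<xi>) * kappa c \<theta> (x - \<xi>) \<tau>)"
proof (induction m)
  case (Suc m)
  show ?case
    by (simp add: Suc.IH fun_eq_iff)
       (rule allI, rule DERIV_imp_deriv, rule DERIV_cong[OF DERIV_poly_kappa[OF assms]], simp)
qed simp

text \<open>\<open>deriv\<close> is a total function, so differentiability has to be established
  separately; the closed form supplies it at every order.\<close>

lemma DERIV_deriv_funpow_kappa:
  "((deriv ^^ m) (\<lambda>x. kappa c \<theta> (x - \<xi>) \<tau>) has_real_derivative
    (deriv ^^ Suc m) (\<lambda>x. kappa c \<theta> (x - \<xi>) \<tau>) x) (at x)"
  unfolding deriv_funpow_kappa[OF refl] kappa_deriv_factor.simps by (rule DERIV_poly_kappa) simp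

text \<open>The real supremum is an upper bound only for sets bounded above. The derivative depends
  on z - \<open>\<xi>\<close> alone, which ranges over the compact interval [-1, 1], and is
  continuous there.\<close>

lemma bdd_above_deriv_funpow_kappa:
  "bdd_above ((\<lambda>(z, \<xi>). \<bar>(deriv ^^ r) (\<lambda>x. kappa c \<theta> (x - \<xi>) \<tau>) z\<bar>) ` ({0..1} \<times> {0..1}))"
proof -
  let ?q = "kappa_deriv_factor (\<theta>\<^sup>2 / (4 * c\<^sup>2 * \<tau>)) r"
  obtain B where B: "\<And>y. y \<in> {-1..1} \<Longrightarrow> \<bar>poly ?q y * kappa c \<theta> y \<tau>\<bar> \<le> B"
    by (rule continuous_on_interval_bounded[of "-1" 1 "\<lambda>y. poly ?q y * kappa c \<theta> y \<tau>"])
       (auto intro!: continuous_intros continuous_on_kappa)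
  show ?thesis
    unfolding deriv_funpow_kappa[OF refl] by (intro bdd_aboveI[of _ B]) (auto intro!: B)
qed

section \<open>Best approximation in \<open>poly_space\<close> and the resulting operator
  bound\<close>

section \<open>The projection error\<close>

text \<open>Pythagoras: x - y splits into the residual x - \<open>?p\<close> and the vector
  \<open>?p\<close> - y of the span, which are orthogonal.\<close>

lemma orth_proj_span_le:
  fixes B :: "'a::real_inner set"
  assumes "finite B" "y \<in> span B"
  shows "norm (orth_proj (span B) x - x) \<le> norm (x - y)"
proof -
  note p = orth_proj_span[OF assms(1)]
  let ?p = "orth_proj (span B) x"
  have "orthogonal (x - ?p) (?p - y)" by (intro p span_diff assms)
  then have "(norm ((x - ?p) + (?p - y)))\<^sup>2 = (norm (x - ?p))\<^sup>2 + (norm (?p - y))\<^sup>2"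
    by (rule norm_add_Pythagorean)
  then have "(norm (x - ?p))\<^sup>2 \<le> (norm (x - y))\<^sup>2" by simp
  then show ?thesis by (simp add: norm_minus_commute power2_le_iff_abs_le)
qed

lemma poly_proj_le:
  assumes "r \<ge> 1" "G \<in> poly_space r J"
  shows "norm (poly_proj r J F - F) \<le> norm (F - G)"
  using assms(2) unfolding poly_proj_def poly_space_eq_span[OF assms(1)]
  by (intro orth_proj_span_le) auto

lemma L2_rep:
  obtains f where "F = abs_L2 f" "square_integrable f"
  using Quotient_abs_rep[OF Quotient_L2] Quotient_rep_reflp[OF Quotient_L2] by (metis ae_eq_def)

text \<open>Cauchy-Schwarz, together with the fact that on an interval of measure 1 a uniform bound
  also bounds the norm in \<open>L2\<close>.\<close>

lemma abs_integral_mult_le: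
  assumes "square_integrable k" "square_integrable f" "0 \<le> B" "\<And>x. x \<in> {0..1} \<Longrightarrow> \<bar>k x\<bar> \<le> B"
  shows "\<bar>\<integral>x. k x * f x \<partial>lebesgue_on {0..1}\<bar> \<le> B * norm (abs_L2 f)"
proof -
  have "(\<integral>x. k x * f x \<partial>lebesgue_on {0..1}) = inner (abs_L2 k) (abs_L2 f)"
    using assms(1,2) by (simp add: inner_L2.abs_eq ae_eq_def)
  also have "\<bar>\<dots>\<bar> \<le> norm (abs_L2 k) * norm (abs_L2 f)" by (rule Cauchy_Schwarz_ineq2)
  also have "\<dots> \<le> B * norm (abs_L2 f)"
    by (intro mult_right_mono norm_abs_L2_le assms) auto
  finally show ?thesis .
qed

text \<open>The estimate is asked for on [0, 1) only, since the half-open dyadic intervals miss the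
  point 1. Cutting the difference off there, as \<open>?v\<close>, leaves its class unchanged and
  makes the bound hold everywhere.\<close>

lemma norm_diff_abs_L2_le:
  assumes f: "square_integrable f" and g: "square_integrable g"
    and B: "0 \<le> B" "\<And>x. x \<in> {0..<1} \<Longrightarrow> \<bar>f x - g x\<bar> \<le> B"
  shows "norm (abs_L2 f - abs_L2 g) \<le> B"
proof -
  let ?d = "\<lambda>x. f x + (-1) * g x"
  let ?v = "\<lambda>x. indicator {0..<1} x * ?d x"
  have d: "square_integrable ?d" by (intro square_integrable_add square_integrable_scale f g)
  have i: "indicator {0..<1::real} \<in> borel_measurable (lebesgue_on {0..1::real})"
    by (intro measurable_restrict_space1 measurable_completion) simp
  have le: "\<bar>?v x\<bar> \<le> B" for x using B by (auto simp: indicator_def)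
  have "square_integrable ?v"
    using d le
    by (intro square_integrable_bounded[where B = B] borel_measurable_times i)
       (auto simp: square_integrable_def)
  moreover have "abs_L2 ?d = abs_L2 f - abs_L2 g"
    by (simp only: abs_L2_add f g square_integrable_scale abs_L2_scale) simp
  moreover have "abs_L2 ?d = abs_L2 ?v"
    by (rule abs_L2_cong) (use d calculation in auto)
  ultimately show ?thesis using norm_abs_L2_le[of ?v B] B(1) le by metis
qed

text \<open>Combining the functions \<open>local_monomial\<close> yields square integrability at
  once, where a definition by cases would need a separate measurability argument.\<close>

lemma piecewise_poly_realization:
  assumes "\<And>i. i \<in> {1..2 ^ J} \<Longrightarrow> degree (q i) < r"
  obtains h where "square_integrable h" "piecewise_poly r J h"
    "\<And>i x. i \<in> {1..2 ^ J} \<Longrightarrow> x \<in> {(real i - 1) / 2 ^ J ..< real i / 2 ^ J} \<Longrightarrow> h x = poly (q i) x"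
proof
  let ?h = "\<lambda>x. \<Sum>(i, k)\<in>{1..2 ^ J} \<times> {..<r}. coeff (q i) k * local_monomial J i k x"
  show "square_integrable ?h"
    by (intro square_integrable_sum)
       (auto intro!: square_integrable_scale square_integrable_local_monomial)
  show eq: "?h x = poly (q i) x"
    if i: "i \<in> {1..2 ^ J}" and x: "x \<in> {(real i - 1) / 2 ^ J ..< real i / 2 ^ J}" for i x
    unfolding sum_local_monomial[OF i x] poly_altdef using assms[OF i]
    by (intro sum.mono_neutral_right) (auto simp: coeff_eq_0)
  show "piecewise_poly r J ?h"
    unfolding piecewise_poly_def using assms eq by blast
qed

lemma square_integrable_kappa:
  "square_integrable (\<lambda>\<xi>. kappa c \<theta> (z - \<xi>) \<tau>)"
proof -
  have cont: "continuous_on {0..1} (\<lambda>\<xi>. kappa c \<theta> (z - \<xi>) \<tau>)"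
    by (intro continuous_on_compose2[OF continuous_on_kappa[of UNIV]] continuous_intros) auto
  obtain B where "\<And>x. x \<in> {0..1} \<Longrightarrow> \<bar>kappa c \<theta> (z - x) \<tau>\<bar> \<le> B"
    by (rule continuous_on_interval_bounded[OF cont]) blast
  moreover have "(\<lambda>\<xi>. kappa c \<theta> (z - \<xi>) \<tau>) \<in> borel_measurable (lebesgue_on {0..1})"
    using cont by (rule continuous_imp_measurable_on_sets_lebesgue) simp
  ultimately show ?thesis by (rule square_integrable_bounded[rotated])
qed

text \<open>The error for \<open>g\<close> is the integral of \<open>?e\<close> against
  \<open>f\<close>, where \<open>?e\<close> is the error of interpolating the kernel in its first
  variable with \<open>\<xi>\<close> fixed. The remainder formula bounds \<open>?e\<close> uniformly
  in \<open>\<xi>\<close>, and Cauchy-Schwarz concludes.\<close>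

lemma convolution_interpolation_error:
  assumes f: "square_integrable f" and N: "finite N" "N \<noteq> {}" "N \<subseteq> {a..b}"
    and z: "z \<in> {a..b}" and w: "\<bar>\<Prod>x\<in>N. z - x\<bar> \<le> W"
    and S: "\<And>\<eta> \<xi>. \<eta> \<in> {a..b} \<Longrightarrow> \<xi> \<in> {0..1} \<Longrightarrow>
      \<bar>(deriv ^^ card N) (\<lambda>x. kappa c \<theta> (x - \<xi>) \<tau>) \<eta>\<bar> \<le> S"
  defines "g \<equiv> \<lambda>z. \<integral>\<xi>. kappa c \<theta> (z - \<xi>) \<tau> * f \<xi> \<partial>lebesgue_on {0..1}"
  shows "\<bar>g z - poly (lagrange_interpolant N g) z\<bar> \<le> S / fact (card N) * W * norm (abs_L2 f)"
proof -
  let ?M = "lebesgue_on {0..1::real}"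
  let ?k = "\<lambda>z \<xi>. kappa c \<theta> (z - \<xi>) \<tau>"
  \<comment> \<open>The point \<open>z\<close> is fixed, so the basis values \<open>?l\<close> are
    constants under the integral. In \<open>?e\<close> the difference is written as adding (-1)
    times the sum, to match the closure rules for \<open>square_integrable\<close>.\<close>
  let ?l = "\<lambda>x. poly (lagrange_basis N x) z"
  let ?e = "\<lambda>\<xi>. ?k z \<xi> + (-1) * (\<Sum>x\<in>N. ?l x * ?k x \<xi>)"
  have S0: "0 \<le> S" using S[OF z, of 0] by fastforce
  have W0: "0 \<le> W" using w by linarith
  have e: "?e \<xi> = ?k z \<xi> - poly (lagrange_interpolant N (\<lambda>x. ?k x \<xi>)) z" for \<xi>
    by (simp add: lagrange_interpolant_def poly_sum mult.commute)
  have bound: "\<bar>?e \<xi>\<bar> \<le> S / fact (card N) * W" if \<xi>: "\<xi> \<in> {0..1}" for \<xi>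
  proof -
    let ?D = "\<lambda>m. (deriv ^^ m) (\<lambda>x. kappa c \<theta> (x - \<xi>) \<tau>)"
    \<comment> \<open>\<open>\<eta>\<close> depends on \<open>\<xi>\<close>, so \<open>S\<close> has
      to bound the derivative uniformly in both variables.\<close>
    obtain \<eta> where \<eta>: "\<eta> \<in> {a..b}" "?D 0 z - poly (lagrange_interpolant N (\<lambda>x. ?k x \<xi>)) z
        = ?D (card N) \<eta> / fact (card N) * (\<Prod>x\<in>N. z - x)"
      using interpolation_error[OF N(1,3) z, of ?D "lagrange_interpolant N (\<lambda>x. ?k x \<xi>)"]
        DERIV_deriv_funpow_kappa degree_lagrange_interpolant[OF N(1,2)]
        poly_lagrange_interpolant[OF N(1)] by auto
    have "\<bar>?e \<xi>\<bar> = \<bar>?D (card N) \<eta>\<bar> / fact (card N) * \<bar>\<Prod>x\<in>N. z - x\<bar>"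
      unfolding e using \<eta>(2) by (simp add: abs_mult)
    also have "\<dots> \<le> S / fact (card N) * W"
      using S0 by (intro mult_mono divide_right_mono S \<eta> \<xi> w) auto
    finally show ?thesis .
  qed
  have int: "integrable ?M (\<lambda>\<xi>. ?k x \<xi> * f \<xi>)" for x
    by (rule square_integrable_mult[OF square_integrable_kappa f])
  have "g z - poly (lagrange_interpolant N g) z = g z - (\<Sum>x\<in>N. ?l x * g x)"
    by (simp add: lagrange_interpolant_def poly_sum mult.commute)
  also have "\<dots> = (\<integral>\<xi>. ?k z \<xi> * f \<xi> - (\<Sum>x\<in>N. ?l x * (?k x \<xi> * f \<xi>)) \<partial>?M)"
    unfolding g_def using int
    by (simp add: Bochner_Integration.integral_diff Bochner_Integration.integral_sum)
  also have "\<dots> = (\<integral>\<xi>. ?e \<xi> * f \<xi> \<partial>?M)"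
    by (simp add: algebra_simps sum_distrib_left sum_negf)
  also have "\<bar>\<dots>\<bar> \<le> S / fact (card N) * W * norm (abs_L2 f)"
    using S0 W0 f bound
    by (intro abs_integral_mult_le square_integrable_add square_integrable_scale
        square_integrable_sum square_integrable_kappa) auto
  finally show ?thesis .
qed

lemma projection_error_le:
  assumes r: "r \<ge> 1"
    and S: "\<And>z \<xi>. z \<in> {0..1} \<Longrightarrow> \<xi> \<in> {0..1} \<Longrightarrow>
      \<bar>(deriv ^^ r) (\<lambda>x. kappa c \<theta> (x - \<xi>) \<tau>) z\<bar> \<le> S"
  shows "norm (poly_proj r J (integral_op c \<theta> \<tau> F) - integral_op c \<theta> \<tau> F)
    \<le> S / fact r * (2 * (1 / 2 ^ J / 4) ^ r) * norm F"
proof -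
  obtain f where F: "F = abs_L2 f" and f: "square_integrable f" by (rule L2_rep)
  define g where "g = (\<lambda>z. \<integral>\<xi>. kappa c \<theta> (z - \<xi>) \<tau> * f \<xi> \<partial>lebesgue_on {0..1})"
  have G: "integral_op c \<theta> \<tau> F = abs_L2 g"
    using f by (simp add: F g_def integral_op.abs_eq ae_eq_def)
  have g: "square_integrable g"
    unfolding g_def by (rule square_integrable_convolution[OF continuous_on_kappa f])
  have S0: "0 \<le> S" using S[of 0 0] by fastforce
  let ?a = "\<lambda>i::nat. (real i - 1) / 2 ^ J" and ?b = "\<lambda>i::nat. real i / 2 ^ J"
  \<comment> \<open>Nodes are chosen for every natural number i, so that a single function
    \<open>N\<close> can be extracted; the range of i matters only once the intervals must lie in
    [0, 1].\<close>
  have "\<exists>N. finite N \<and> card N = r \<and> N \<subseteq> {?a i..?b i} \<and>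
      (\<forall>z\<in>{?a i..?b i}. \<bar>\<Prod>x\<in>N. z - x\<bar> \<le> 2 * (1 / 2 ^ J / 4) ^ r)" for i
  proof -
    have "?a i < ?b i" by (simp add: divide_strict_right_mono)
    moreover have "?b i - ?a i = 1 / 2 ^ J" by (simp add: field_simps)
    ultimately show ?thesis using chebyshev_nodes_interval[OF r, of "?a i" "?b i"] by metis
  qed
  then obtain N where N: "\<And>i. finite (N i)" "\<And>i. card (N i) = r" "\<And>i. N i \<subseteq> {?a i..?b i}"
    "\<And>i z. z \<in> {?a i..?b i} \<Longrightarrow> \<bar>\<Prod>x\<in>N i. z - x\<bar> \<le> 2 * (1 / 2 ^ J / 4) ^ r"
    by metis
  have N0: "N i \<noteq> {}" for i using N(2)[of i] r by auto
  have "degree (lagrange_interpolant (N i) g) < r" for i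
    using degree_lagrange_interpolant[OF N(1) N0] N(2) by metis
  then obtain h where h: "square_integrable h" "piecewise_poly r J h"
    "\<And>i x. i \<in> {1..2 ^ J} \<Longrightarrow> x \<in> {?a i..<?b i} \<Longrightarrow> h x = poly (lagrange_interpolant (N i) g) x"
    using piecewise_poly_realization[of J "\<lambda>i. lagrange_interpolant (N i) g" r] by metis
  have "norm (abs_L2 g - abs_L2 h) \<le> S / fact r * (2 * (1 / 2 ^ J / 4) ^ r) * norm F"
  proof (rule norm_diff_abs_L2_le[OF g h(1)])
    fix z :: real assume "z \<in> {0..<1}"
    then obtain i where i: "i \<in> {1..2 ^ J}" "z \<in> {?a i..<?b i}" by (rule dyadic_interval_ex1)
    have z: "z \<in> {?a i..?b i}" using i(2) by auto
    \<comment> \<open>With 1 <= i <= 2^J the closed interval stays inside [0, 1], where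
      \<open>S\<close> bounds the derivative.\<close>
    have "real i \<le> 2 ^ J" using i(1) by (simp add: numeral_power_eq_of_nat_cancel_iff)
    then have sub: "{?a i..?b i} \<subseteq> {0..1}" using i(1) by (auto simp: field_simps intro: order_trans)
    show "\<bar>g z - h z\<bar> \<le> S / fact r * (2 * (1 / 2 ^ J / 4) ^ r) * norm F"
      using convolution_interpolation_error[OF f N(1) N0 N(3) z N(4)[OF z], of c \<theta> \<tau> S] S sub
      by (simp add: h(3)[OF i] F N(2) subset_iff g_def)
  qed (use S0 in simp)
  moreover have "abs_L2 h \<in> poly_space r J" using h by (auto simp: poly_space_def)
  ultimately show ?thesis using poly_proj_le[OF r] G order_trans by metis
qed

theorem mainTheorem2:
  fixes \<sigma> L U T \<tau> c \<theta> :: real and M r J :: nat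
  assumes "\<sigma> > 0" and "0 < L" and "L < U" and "T > 0" and "M \<ge> 1"
    and "\<tau> = T / real M" and "c\<^sup>2 = \<sigma>\<^sup>2 / 2" and "\<theta> = ln (U / L)"
    and "r \<ge> 1"
  shows "onorm (\<lambda>F. poly_proj r J (integral_op c \<theta> \<tau> F) - integral_op c \<theta> \<tau> F)
    \<le> 2 powi (- int (J * r) + 1) / (4 ^ r * fact r) *
      (SUP (z, \<xi>) \<in> {0..1} \<times> {0..1}. \<bar>(deriv ^^ r) (\<lambda>x. kappa c \<theta> (x - \<xi>) \<tau>) z\<bar>)"
proof -
  let ?d = "\<lambda>z \<xi>. \<bar>(deriv ^^ r) (\<lambda>x. kappa c \<theta> (x - \<xi>) \<tau>) z\<bar>"
  let ?S = "SUP (z, \<xi>) \<in> {0..1} \<times> {0..1}. ?d z \<xi>"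
  have S: "?d z \<xi> \<le> ?S" if "z \<in> {0..1}" "\<xi> \<in> {0..1}" for z \<xi>
    using cSUP_upper[OF _ bdd_above_deriv_funpow_kappa, of "(z, \<xi>)"] that by simp
  \<comment> \<open>The stated constant is 2 (h/4)^r / r! with h = 2^(-J), the bound for Chebyshev
    nodes on one dyadic interval.\<close>
  have "(2::real) powi (- int (J * r) + 1) = 2 / 2 ^ (J * r)"
    by (subst power_int_add) (simp_all add: power_int_minus divide_inverse del: of_nat_mult)
  then have C: "2 powi (- int (J * r) + 1) / (4 ^ r * fact r) * ?S
      = ?S / fact r * (2 * (1 / 2 ^ J / 4) ^ r)"
    by (simp add: power_divide power_mult power_mult_distrib field_simps)
  show ?thesis
    unfolding C
  proof (rule onorm_bound)
    have "0 \<le> ?S" using order_trans[OF abs_ge_zero S[of 0 0]] by simp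
    then show "0 \<le> ?S / fact r * (2 * (1 / 2 ^ J / 4) ^ r)" by simp
  qed (rule projection_error_le[OF \<open>r \<ge> 1\<close> S])
qed

end
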